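(* Let $A,B,C_1,\dots,C_p,D_1,\dots,D_q\in\mathbb{C}^{r\times r}$. Suppose that $C_1,\dots,C_p$ are positive stable and that, for every $1\le i\le p$, $C_iC_k=C_kC_i$ for all $1\le k<i$, $C_iA=AC_i$ and $C_iB=BC_i$. Suppose also that, for every $1\le j\le q$, $D_jD_k=D_kD_j$ for all $j<k\le q$. Let $R={}_pR_q(A,B;z)$, let $R(C_i+)$ be the function obtained from $R$ by replacing $C_i$ by $C_i+I$, let $R(D_j-)$ be the function obtained from $R$ by replacing $D_j$ by $D_j-I$ (all other parameters unchanged), and let $\theta=z\frac{d}{dz}$. Then: (a) $(\theta+C_i)R=C_i\,R(C_i+)$ for $1\le i\le p$; (b) $\theta R+R\,(D_j-I)=R(D_j-)\,(D_j-I)$ for $1\le j\le q$; (c) $C_i\,R-R\,(D_j-I)=C_i\,R(C_i+)-R(D_j-)\,(D_j-I)$ for $1\le i\le p$, $1\le j\le q$; (d) $(C_1-C_i)R=C_1\,R(C_1+)-C_i\,R(C_i+)$ for $2\le i\le p$; (e) $C_1\,R-R\,(D_j-I)=C_1\,R(C_1+)-R(D_j-)\,(D_j-I)$ for $1\le j\le q$.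
   Context: A matrix is positive stable if all its eigenvalues have positive real part. The Pochhammer symbol of $M\in\mathbb{C}^{r\times r}$ is $(M)_0=I$, $(M)_n=M(M+I)\cdots(M+(n-1)I)$ for $n\ge 1$. $\Gamma^{-1}(M)$ denotes the entire function $1/\Gamma$ applied to $M$. For matrices $A,B,C_1,\dots,C_p,D_1,\dots,D_q\in\mathbb{C}^{r\times r}$ such that each $D_j+kI$ is invertible for all integers $k\ge 0$, one defines $${}_pR_q(A,B;z)={}_pR_q\left(\begin{array}{c}C_1,\dots,C_p\\ D_1,\dots,D_q\end{array}\mid A,B;z\right)=\sum_{n\ge 0}\Gamma^{-1}(nA+B)\,(C_1)_n\cdots(C_p)_n\,(D_1)_n^{-1}\cdots(D_q)_n^{-1}\,\frac{z^n}{n!},$$ with products taken in the written order. The invertibility condition in this definition is assumed for the parameters of every function ${}_pR_q$ appearing (in particular for $D_j-I$ in $R(D_j-)$). *)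

theory Defs
  imports "HOL-Analysis.Analysis"
begin

text \<open>Matrices of size r are of type \<^typ>\<open>complex^'n^'n\<close> with r = CARD('n). On this type the
  type class operation \<open>*\<close> is entrywise; the matrix product is \<open>**\<close>, and the scalar
  matrix c I is \<open>mat c\<close>.\<close>

definition mscale :: "complex \<Rightarrow> complex^'n^'n \<Rightarrow> complex^'n^'n" where
  "mscale c M = map_matrix (\<lambda>x. c * x) M"

definition mprod :: "(complex^'n^'n) list \<Rightarrow> complex^'n^'n" where
  "mprod Ms = foldr (**) Ms (mat 1)"

definition is_eigenvalue :: "complex^'n^'n \<Rightarrow> complex \<Rightarrow> bool" where
  "is_eigenvalue M l \<longleftrightarrow> (\<exists>v. v \<noteq> 0 \<and> M *v v = l *s v)"

definition positive_stable :: "complex^'n^'n \<Rightarrow> bool" where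
  "positive_stable M \<longleftrightarrow> (\<forall>l. is_eigenvalue M l \<longrightarrow> Re l > 0)"

primrec mpochhammer :: "complex^'n^'n \<Rightarrow> nat \<Rightarrow> complex^'n^'n" where
  "mpochhammer M 0 = mat 1"
| "mpochhammer M (Suc n) = mpochhammer M n ** (M + mat (of_nat n))"

text \<open>An entire function applied to a matrix, through its Taylor series at 0.\<close>

definition entire_mat :: "(complex \<Rightarrow> complex) \<Rightarrow> complex^'n^'n \<Rightarrow> complex^'n^'n" where
  "entire_mat f M = (\<Sum>k. mscale ((deriv ^^ k) f 0 / fact k) ((((**) M) ^^ k) (mat 1)))"

definition rGamma_mat :: "complex^'n^'n \<Rightarrow> complex^'n^'n" where
  "rGamma_mat M = entire_mat rGamma M"

text \<open>The parameters C_1, ..., C_p and D_1, ..., D_q are the values of functions \<open>C\<close> and \<open>D\<close> at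
  1, ..., p and 1, ..., q; other values play no role.\<close>

definition pRq_term :: "nat \<Rightarrow> nat \<Rightarrow> (nat \<Rightarrow> complex^'n^'n) \<Rightarrow> (nat \<Rightarrow> complex^'n^'n) \<Rightarrow>
    complex^'n^'n \<Rightarrow> complex^'n^'n \<Rightarrow> complex \<Rightarrow> nat \<Rightarrow> complex^'n^'n" where
  "pRq_term p q C D A B z n =
     mscale (z ^ n / fact n)
       (rGamma_mat (mscale (of_nat n) A + B)
        ** mprod (map (\<lambda>i. mpochhammer (C i) n) [1..<Suc p])
        ** mprod (map (\<lambda>j. matrix_inv (mpochhammer (D j) n)) [1..<Suc q]))"

definition pRq :: "nat \<Rightarrow> nat \<Rightarrow> (nat \<Rightarrow> complex^'n^'n) \<Rightarrow> (nat \<Rightarrow> complex^'n^'n) \<Rightarrow>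
    complex^'n^'n \<Rightarrow> complex^'n^'n \<Rightarrow> complex \<Rightarrow> complex^'n^'n" where
  "pRq p q C D A B z = (\<Sum>n. pRq_term p q C D A B z n)"

definition pRq_domain :: "nat \<Rightarrow> nat \<Rightarrow> (nat \<Rightarrow> complex^'n^'n) \<Rightarrow> (nat \<Rightarrow> complex^'n^'n) \<Rightarrow>
    complex^'n^'n \<Rightarrow> complex^'n^'n \<Rightarrow> complex set" where
  "pRq_domain p q C D A B = {z. summable (pRq_term p q C D A B z)}"

text \<open>The standing condition on the lower parameters, without which the inverses in
  \<^const>\<open>pRq_term\<close> are meaningless.\<close>

definition lower_admissible :: "nat \<Rightarrow> (nat \<Rightarrow> complex^'n^'n) \<Rightarrow> bool" where
  "lower_admissible q D \<longleftrightarrow> (\<forall>j\<in>{1..q}. \<forall>k::nat. invertible (D j + mat (of_nat k)))"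

text \<open>The operator z d/dz; the derivative of a matrix function is taken entrywise.\<close>

definition theta :: "(complex \<Rightarrow> complex^'n^'n) \<Rightarrow> complex \<Rightarrow> complex^'n^'n" where
  "theta F z = (\<chi> a b. z * deriv (\<lambda>w. F w $ a $ b) z)"

definition shift_up :: "(nat \<Rightarrow> complex^'n^'n) \<Rightarrow> nat \<Rightarrow> nat \<Rightarrow> complex^'n^'n" where
  "shift_up C i = C(i := C i + mat 1)"

definition shift_down :: "(nat \<Rightarrow> complex^'n^'n) \<Rightarrow> nat \<Rightarrow> nat \<Rightarrow> complex^'n^'n" where
  "shift_down D j = D(j := D j - mat 1)"

end

theory Submission
  imports Defs "HOL-Complex_Analysis.Cauchy_Integral_Formula"
begin

text \<open>All identities hold term by term. Let T(n) be the n-th term of R. Since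
  C (C + I)_n = (C + n I) (C)_n and the C_i commute with everything to their left, the n-th term of
  C_i R(C_i+) is (n I + C_i) T(n); likewise that of R(D_j-) (D_j - I) is T(n) (n I + D_j - I).
  Inside the region of convergence the series of n T(n) converges to \<open>theta R\<close>, and as C_i and
  D_j - I are invertible, the contiguous series converge there too. In (c), (d) and (e) the
  factor n cancels, so that plain convergence of the series involved suffices.\<close>

section \<open>Matrix algebra\<close>

text \<open>An abbreviation rather than a definition, so that a commutation fact is itself an
  equation that the simplifier can rewrite with.\<close>

abbreviation (input) commutes :: "complex^'n^'n \<Rightarrow> complex^'n^'n \<Rightarrow> bool" where
  "commutes M N \<equiv> M ** N = N ** M"

section \<open>Scalar multiples and distributivity\<close>

lemma mscale_nth [simp]: "mscale c M $ a $ b = c * M $ a $ b"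
  by (simp add: mscale_def map_matrix_def)

lemma mscale_mult_left: "mscale c M ** N = mscale c (M ** N)"
  by (simp add: vec_eq_iff matrix_matrix_mult_def sum_distrib_left mult.assoc)

lemma mscale_mult_right: "M ** mscale c N = mscale c (M ** N)"
  by (simp add: vec_eq_iff matrix_matrix_mult_def sum_distrib_left mult.left_commute)

lemma mscale_mscale: "mscale c (mscale d M) = mscale (c * d) M"
  by (simp add: vec_eq_iff mult.assoc)

lemma mat_eq_mscale: "mat c = mscale c (mat 1)"
  by (simp add: vec_eq_iff mat_def)

lemma mat_mult_left: "mat c ** M = mscale c M"
  by (subst mat_eq_mscale) (simp add: mscale_mult_left)

lemma mat_mult_right: "M ** mat c = mscale c M"
  by (subst mat_eq_mscale) (simp add: mscale_mult_right)

lemma matrix_add_rdistrib: "(N + P) ** (M::complex^'n^'n) = N ** M + P ** M"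
  by (simp add: vec_eq_iff matrix_matrix_mult_def sum.distrib algebra_simps)

lemma matrix_diff_ldistrib: "(M::complex^'n^'n) ** (N - P) = M ** N - M ** P"
  by (simp add: vec_eq_iff matrix_matrix_mult_def sum_subtractf algebra_simps)

lemma matrix_diff_rdistrib: "(N - P) ** (M::complex^'n^'n) = N ** M - P ** M"
  by (simp add: vec_eq_iff matrix_matrix_mult_def sum_subtractf algebra_simps)

lemma norm_mscale: "norm (mscale c M) = norm c * norm M"
  by (simp add: norm_vec_def norm_mult flip: L2_set_right_distrib)

text \<open>Linear maps on a finite-dimensional space are bounded. Hence multiplication by a fixed
  matrix may be applied to a convergent series term by term.\<close>

lemma bounded_linear_matrix_mult_left: "bounded_linear (\<lambda>N. (M::complex^'n^'n) ** (N::complex^'n^'n))"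
proof -
  have "linear (\<lambda>N::complex^'n^'n. M ** N)"
  proof (rule linearI)
    show "M ** (c *\<^sub>R N) = c *\<^sub>R (M ** N)" for c N
      by (simp add: vec_eq_iff matrix_matrix_mult_def scaleR_sum_right)
  qed (rule matrix_add_ldistrib)
  then show ?thesis
    by (simp add: linear_conv_bounded_linear)
qed

lemma bounded_linear_matrix_mult_right: "bounded_linear (\<lambda>N. (N::complex^'n^'n) ** (M::complex^'n^'n))"
proof -
  have "linear (\<lambda>N::complex^'n^'n. N ** M)"
  proof (rule linearI)
    show "(c *\<^sub>R N) ** M = c *\<^sub>R (N ** M)" for c N
      by (simp add: vec_eq_iff matrix_matrix_mult_def scaleR_sum_right)
  qed (rule matrix_add_rdistrib)
  then show ?thesis
    by (simp add: linear_conv_bounded_linear)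
qed

section \<open>Inverses and invertible factors of series\<close>

lemma
  fixes M :: "complex^'n^'n"
  assumes "invertible M"
  shows matrix_inv_left: "matrix_inv M ** M = mat 1"
    and matrix_inv_right: "M ** matrix_inv M = mat 1"
  using someI_ex[OF assms[unfolded invertible_def]] unfolding matrix_inv_def by blast+

text \<open>Multiplying by the inverse undoes the factor. This later carries convergence from the
  series multiplied by \<open>C i\<close> to the contiguous series itself.\<close>

lemma summable_matrix_mult_left_iff:
  fixes M :: "complex^'n^'n" and f :: "nat \<Rightarrow> complex^'n^'n"
  assumes "invertible M"
  shows "summable (\<lambda>n. M ** f n) \<longleftrightarrow> summable f"
proof
  assume "summable (\<lambda>n. M ** f n)"
  then have "summable (\<lambda>n. matrix_inv M ** (M ** f n))"
    by (rule bounded_linear.summable[OF bounded_linear_matrix_mult_left])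
  then show "summable f"
    by (simp add: matrix_mul_assoc matrix_inv_left[OF assms])
qed (rule bounded_linear.summable[OF bounded_linear_matrix_mult_left])

lemma summable_matrix_mult_right_iff:
  fixes M :: "complex^'n^'n" and f :: "nat \<Rightarrow> complex^'n^'n"
  assumes "invertible M"
  shows "summable (\<lambda>n. f n ** M) \<longleftrightarrow> summable f"
proof
  assume "summable (\<lambda>n. f n ** M)"
  then have "summable (\<lambda>n. (f n ** M) ** matrix_inv M)"
    by (rule bounded_linear.summable[OF bounded_linear_matrix_mult_right])
  then show "summable f"
    by (simp add: matrix_inv_right[OF assms] flip: matrix_mul_assoc)
qed (rule bounded_linear.summable[OF bounded_linear_matrix_mult_right])

text \<open>A nonzero kernel vector would make 0 an eigenvalue, whose real part is not
  positive.\<close>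

lemma positive_stable_invertible:
  fixes M :: "complex^'n^'n"
  assumes "positive_stable M"
  shows "invertible M"
proof -
  have "v = 0" if "M *v v = 0" for v
  proof (rule ccontr)
    assume "v \<noteq> 0"
    then have "is_eigenvalue M 0"
      using that unfolding is_eigenvalue_def by auto
    then show False
      using assms unfolding positive_stable_def by force
  qed
  then show ?thesis
    by (simp add: invertible_left_inverse matrix_left_invertible_ker)
qed

section \<open>Commuting matrices\<close>

lemma commutes_mult: "commutes M N \<Longrightarrow> commutes M P \<Longrightarrow> commutes M (N ** P)"
  by (metis matrix_mul_assoc)

lemma commutes_add: "commutes M N \<Longrightarrow> commutes M P \<Longrightarrow> commutes M (N + P)"
  by (simp add: matrix_add_ldistrib matrix_add_rdistrib)

lemma commutes_mscale: "commutes M N \<Longrightarrow> commutes M (mscale c N)"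
  by (simp add: mscale_mult_left mscale_mult_right)

lemma commutes_mat: "commutes M (mat c)"
  by (simp add: mat_mult_left mat_mult_right)

lemma commutes_matrix_inv:
  assumes "invertible N" "commutes M N"
  shows "commutes M (matrix_inv N)"
proof -
  have "M ** matrix_inv N = matrix_inv N ** (N ** M) ** matrix_inv N"
    by (simp add: matrix_mul_assoc matrix_inv_left[OF assms(1)])
  also have "\<dots> = matrix_inv N ** M ** (N ** matrix_inv N)"
    by (simp add: assms(2)[symmetric] matrix_mul_assoc)
  finally show ?thesis
    by (simp add: matrix_inv_right[OF assms(1)])
qed

lemma commutes_mpochhammer: "commutes M N \<Longrightarrow> commutes M (mpochhammer N n)"
  by (induction n) (auto intro!: commutes_mult commutes_add simp: commutes_mat)

lemma commutes_mprod: "(\<And>N. N \<in> set Ns \<Longrightarrow> commutes M N) \<Longrightarrow> commutes M (mprod Ns)"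
  by (induction Ns) (auto simp: mprod_def intro!: commutes_mult)

section \<open>Powers and entire functions of a matrix\<close>

lemma commutes_power: "commutes M N \<Longrightarrow> commutes M ((((**) N) ^^ k) (mat 1))"
  by (induction k) (auto intro!: commutes_mult)

text \<open>\<open>K\<close> bounds left multiplication by \<open>M\<close> as a linear map. The
  factor \<open>norm (mat 1)\<close> stays because the norm here is the Euclidean norm of the
  entries, in which the identity need not have norm 1.\<close>

lemma norm_matrix_power_bound:
  fixes M :: "complex^'n^'n"
  obtains K where "K \<ge> 0" "\<And>k. norm ((((**) M) ^^ k) (mat 1)) \<le> K ^ k * norm (mat 1 :: complex^'n^'n)"
proof -
  obtain K where K: "K > 0" "\<And>N::complex^'n^'n. norm (M ** N) \<le> norm N * K"
    using bounded_linear.pos_bounded[OF bounded_linear_matrix_mult_left[of M]] by blast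
  have "norm ((((**) M) ^^ k) (mat 1)) \<le> K ^ k * norm (mat 1 :: complex^'n^'n)" for k
  proof (induction k)
    case (Suc k)
    have "norm ((((**) M) ^^ Suc k) (mat 1)) \<le> norm ((((**) M) ^^ k) (mat 1)) * K"
      using K(2) by simp
    also have "\<dots> \<le> K ^ k * norm (mat 1 :: complex^'n^'n) * K"
      using Suc K(1) by (intro mult_right_mono) auto
    finally show ?case
      by (simp add: mult_ac)
  qed simp
  then show thesis
    using K(1) that[of K] by simp
qed

text \<open>Comparison with the scalar Taylor series: it converges at \<open>K + 1\<close>, a point
  of the disc of radius \<open>K + 2\<close>, hence absolutely at the smaller point
  \<open>K\<close>, where it dominates the matrix series.\<close>

lemma summable_entire_mat:
  fixes M :: "complex^'n^'n"
  assumes "f holomorphic_on UNIV"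
  shows "summable (\<lambda>k. mscale ((deriv ^^ k) f 0 / fact k) ((((**) M) ^^ k) (mat 1)))"
proof -
  obtain K where K: "K \<ge> 0"
    "\<And>k. norm ((((**) M) ^^ k) (mat 1)) \<le> K ^ k * norm (mat 1 :: complex^'n^'n)"
    using norm_matrix_power_bound by blast
  have "summable (\<lambda>k. (deriv ^^ k) f 0 / fact k * complex_of_real (K + 1) ^ k)"
  proof (rule sums_summable)
    show "(\<lambda>k. (deriv ^^ k) f 0 / fact k * complex_of_real (K + 1) ^ k) sums f (complex_of_real (K + 1))"
      using holomorphic_power_series[of f 0 "K + 2" "complex_of_real (K + 1)"] K(1)
        holomorphic_on_subset[OF assms]
      by (simp flip: of_real_add del: of_real_add)
  qed
  then have "summable (\<lambda>k. norm ((deriv ^^ k) f 0 / fact k * complex_of_real K ^ k))"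
    by (rule powser_insidea) (use K(1) in \<open>simp del: of_real_add\<close>)
  then have "summable (\<lambda>k. norm ((deriv ^^ k) f 0 / fact k * complex_of_real K ^ k)
      * norm (mat 1 :: complex^'n^'n))"
    by (rule summable_mult2)
  then show ?thesis
  proof (rule summable_comparison_test')
    fix k
    show "norm (mscale ((deriv ^^ k) f 0 / fact k) ((((**) M) ^^ k) (mat 1)))
       \<le> norm ((deriv ^^ k) f 0 / fact k * complex_of_real K ^ k) * norm (mat 1 :: complex^'n^'n)"
      using mult_left_mono[OF K(2)[of k], of "norm ((deriv ^^ k) f 0 / fact k)"] K(1)
      by (simp add: norm_mscale norm_mult norm_divide norm_power mult.assoc)
  qed
qed

text \<open>\<open>M\<close> commutes with every term of the Taylor series, and summability allows
  it to be moved into the sum from either side.\<close>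

lemma commutes_entire_mat:
  assumes "f holomorphic_on UNIV" "commutes M N"
  shows "commutes M (entire_mat f N)"
proof -
  note S = summable_entire_mat[OF assms(1), of N]
  show ?thesis
    unfolding entire_mat_def
    by (simp add: bounded_linear.suminf[OF bounded_linear_matrix_mult_left S]
        bounded_linear.suminf[OF bounded_linear_matrix_mult_right S]
        commutes_mscale[OF commutes_power[OF assms(2)]])
qed

text \<open>\<open>M\<close> travels to the right through the unchanged factors until it meets
  factor \<open>i\<close>, where it turns into \<open>E\<close>; then \<open>E\<close> travels back
  to the front. Distinctness makes \<open>i\<close> the only place where the two products
  differ.\<close>

lemma mprod_replace_factor:
  assumes "distinct xs" "i \<in> set xs" "\<And>k. k \<noteq> i \<Longrightarrow> g k = f k" "M ** g i = E ** f i"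
    and "\<And>k. k \<in> set xs \<Longrightarrow> commutes M (f k)" "\<And>k. k \<in> set xs \<Longrightarrow> commutes E (f k)"
  shows "M ** mprod (map g xs) = E ** mprod (map f xs)"
  using assms
proof (induction xs)
  case (Cons x xs)
  have mprod_Cons: "mprod (map h (x # xs)) = h x ** mprod (map h xs)" for h :: "'a \<Rightarrow> complex^'b^'b"
    by (simp add: mprod_def)
  show ?case
  proof (cases "x = i")
    case True
    have tail: "map g xs = map f xs"
    proof (rule map_cong[OF refl])
      fix k assume "k \<in> set xs"
      then show "g k = f k"
        using Cons.prems(1) True by (intro Cons.prems(3)) auto
    qed
    then show ?thesis
      using True Cons.prems(4) unfolding mprod_Cons tail by (simp add: matrix_mul_assoc)
  next
    case False
    then have IH: "M ** mprod (map g xs) = E ** mprod (map f xs)"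
      using Cons by auto
    have "M ** mprod (map g (x # xs)) = f x ** (M ** mprod (map g xs))"
      using False Cons.prems(3,5) unfolding mprod_Cons by (simp add: matrix_mul_assoc)
    also have "\<dots> = E ** mprod (map f (x # xs))"
      using Cons.prems(6)[of x] unfolding IH mprod_Cons by (simp add: matrix_mul_assoc)
    finally show ?thesis .
  qed
qed simp

section \<open>Contiguous Pochhammer symbols\<close>

text \<open>Both sides equal (M)_{n+1}: on the left \<open>M\<close> supplies the missing first
  factor, on the right the last factor M + nI has been moved to the front.\<close>

lemma mpochhammer_shift_up:
  "M ** mpochhammer (M + mat 1) n = (M + mat (of_nat n)) ** mpochhammer M n"
proof -
  have "M ** mpochhammer (M + mat 1) n = mpochhammer M (Suc n)"
  proof (induction n)
    case 0
    show ?case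
      by simp
  next
    case (Suc n)
    have shift: "M + mat 1 + mat (of_nat n) = M + mat (of_nat (Suc n))"
      by (simp add: vec_eq_iff mat_def)
    show ?case
      using Suc by (simp add: matrix_mul_assoc shift del: of_nat_Suc)
  qed
  also have "\<dots> = (M + mat (of_nat n)) ** mpochhammer M n"
    using commutes_mpochhammer[of "M + mat (of_nat n)" M n]
    by (simp add: matrix_add_ldistrib matrix_add_rdistrib commutes_mat)
  finally show ?thesis .
qed

lemma invertible_mpochhammer:
  assumes "\<And>k::nat. invertible (M + mat (of_nat k))"
  shows "invertible (mpochhammer M n)"
proof (induction n)
  case 0
  show ?case
    unfolding invertible_def by (auto intro!: exI[of _ "mat 1"])
qed (use assms in \<open>simp add: invertible_mult\<close>)

text \<open>The upward shift for N = M - I reads N (M)_n = (N + nI) (N)_n. Dividing by both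
  Pochhammer symbols gives the claim, since N commutes with both and N + nI with (N)_n.\<close>

lemma matrix_inv_mpochhammer_shift_down:
  assumes "\<And>k::nat. invertible (M + mat (of_nat k))" "\<And>k::nat. invertible (M - mat 1 + mat (of_nat k))"
  shows "(M - mat 1) ** matrix_inv (mpochhammer (M - mat 1) n)
    = (M - mat 1 + mat (of_nat n)) ** matrix_inv (mpochhammer M n)"
proof -
  let ?N = "M - mat 1"
  let ?P = "mpochhammer M n" and ?Q = "mpochhammer ?N n"
  note P = invertible_mpochhammer[OF assms(1), of n] and Q = invertible_mpochhammer[OF assms(2), of n]
  have "?N ** ?P = (?N + mat (of_nat n)) ** ?Q"
    using mpochhammer_shift_up[of ?N n] by simp
  moreover have "commutes ?N ?P"
    using commutes_mpochhammer[of ?N M n]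
    by (simp add: matrix_diff_ldistrib matrix_diff_rdistrib commutes_mat)
  moreover have "commutes (?N + mat (of_nat n)) ?Q"
    using commutes_mpochhammer[of "?N + mat (of_nat n)" ?N n]
    by (simp add: matrix_add_ldistrib matrix_add_rdistrib commutes_mat)
  \<comment> \<open>Turned round in this way, the identity loses \<open>?Q\<close> when multiplied
    by its inverse on the left.\<close>
  ultimately have "?P ** ?N = ?Q ** (?N + mat (of_nat n))"
    by simp
  then have "matrix_inv ?Q ** (?P ** ?N) ** matrix_inv ?P = (?N + mat (of_nat n)) ** matrix_inv ?P"
    by (simp add: matrix_mul_assoc matrix_inv_left[OF Q])
  moreover have "matrix_inv ?Q ** (?P ** ?N) ** matrix_inv ?P = matrix_inv ?Q ** ?N"
    unfolding \<open>commutes ?N ?P\<close>[symmetric] by (simp add: matrix_inv_right[OF P] flip: matrix_mul_assoc)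
  moreover have "commutes ?N (matrix_inv ?Q)"
    by (intro commutes_matrix_inv Q commutes_mpochhammer) simp
  ultimately show ?thesis
    by simp
qed

section \<open>Power series with matrix coefficients\<close>

lemma sums_matrix_iff:
  fixes f :: "nat \<Rightarrow> complex^'n^'n"
  shows "f sums S \<longleftrightarrow> (\<forall>a b. (\<lambda>n. f n $ a $ b) sums (S $ a $ b))"
proof
  assume "\<forall>a b. (\<lambda>n. f n $ a $ b) sums (S $ a $ b)"
  then show "f sums S"
    unfolding sums_def by (intro vec_tendstoI) (simp add: sum_component)
qed (auto intro!: sums_vec_nth)

text \<open>Around an interior point of the convergence set there is a point of that set with larger
  modulus. Each entry is then a power series that converges on a disc containing \<open>z\<close>,
  and may be differentiated term by term.\<close>

lemma theta_power_series:
  fixes W :: "nat \<Rightarrow> complex^'n^'n"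
  assumes "z \<in> interior {w. summable (\<lambda>n. mscale (w ^ n) (W n))}"
  shows "(\<lambda>n. mscale (of_nat n) (mscale (z ^ n) (W n))) sums theta (\<lambda>w. \<Sum>n. mscale (w ^ n) (W n)) z"
proof -
  let ?V = "{w. summable (\<lambda>n. mscale (w ^ n) (W n))}"
  let ?F = "\<lambda>w. \<Sum>n. mscale (w ^ n) (W n)"
  obtain e where e: "e > 0" "cball z e \<subseteq> ?V"
    using assms unfolding mem_interior_cball by blast
  \<comment> \<open>The unit direction of \<open>z\<close>. At 0, where \<open>sgn\<close> vanishes,
    any unit number will do. Moving from \<open>z\<close> by \<open>e\<close> along \<open>u\<close>
    raises the modulus by exactly \<open>e\<close>.\<close>
  define u where "u = (if z = 0 then 1 else sgn z)"
  have u: "norm u = 1" "z = of_real (norm z) * u"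
    by (simp_all add: u_def norm_sgn) (simp add: sgn_div_norm scaleR_conv_of_real)
  define x where "x = z + of_real e * u"
  have "x = of_real (norm z + e) * u"
    unfolding x_def by (subst (1) u(2)) (simp add: algebra_simps)
  then have x: "norm x = norm z + e"
    using e(1) u(1) by (simp add: norm_mult del: of_real_add)
  have "x \<in> cball z e"
    using e(1) u(1) by (simp add: x_def dist_norm norm_mult)
  then have "x \<in> ?V"
    using e(2) by blast
  then have "summable (\<lambda>n. mscale (x ^ n) (W n) $ a $ b)" for a b
    by (intro summable_vec_nth) simp
  then have sx: "summable (\<lambda>n. W n $ a $ b * x ^ n)" for a b
    by (simp add: mult.commute)
  have F: "(\<lambda>n. W n $ a $ b * w ^ n) sums (?F w $ a $ b)" if "norm w < norm x" for w a b
  proof -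
    \<comment> \<open>Entrywise convergence is assembled into convergence of matrices, which shows
      that the entries of \<open>?F w\<close> are the scalar sums.\<close>
    define S where "S = (\<chi> a b. \<Sum>n. W n $ a $ b * w ^ n)"
    have "(\<lambda>n. W n $ a $ b * w ^ n) sums (S $ a $ b)" for a b
      using powser_inside[OF sx that] by (simp add: S_def summable_sums)
    then have "(\<lambda>n. mscale (w ^ n) (W n)) sums S"
      by (simp add: sums_matrix_iff mult.commute)
    then have "(\<lambda>n. mscale (w ^ n) (W n)) sums ?F w"
      by (simp add: sums_iff)
    then show ?thesis
      by (simp add: sums_matrix_iff mult.commute)
  qed
  show ?thesis
    unfolding sums_matrix_iff
  proof (intro allI)
    fix a b
    let ?c = "\<lambda>n. W n $ a $ b"
    have nz: "norm z < norm x"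
      using x e(1) by simp
    have "((\<lambda>w. \<Sum>n. ?c n * w ^ n) has_field_derivative (\<Sum>n. diffs ?c n * z ^ n)) (at z)"
      by (rule termdiffs_strong[OF sx nz])
    then have "((\<lambda>w. ?F w $ a $ b) has_field_derivative (\<Sum>n. diffs ?c n * z ^ n)) (at z)"
      by (rule has_field_derivative_transform_within_open[where S = "ball 0 (norm x)"])
         (use nz F in \<open>auto simp: sums_iff\<close>)
    then have deriv: "deriv (\<lambda>w. ?F w $ a $ b) z = (\<Sum>n. diffs ?c n * z ^ n)"
      by (rule DERIV_imp_deriv)
    have "summable (\<lambda>n. diffs ?c n * z ^ n)"
      by (rule termdiff_converges[OF nz]) (use F sums_summable in blast)
    from sums_mult[OF diffs_equiv[OF this], of z]
    have "(\<lambda>n. z * (of_nat n * ?c n * z ^ (n - Suc 0))) sums (z * deriv (\<lambda>w. ?F w $ a $ b) z)"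
      unfolding deriv .
    \<comment> \<open>For n = 0 the truncated exponent is 0, but the factor \<open>of_nat n\<close>
      makes both sides vanish.\<close>
    moreover have "z * (of_nat n * ?c n * z ^ (n - Suc 0)) = of_nat n * (z ^ n * ?c n)" for n
      by (cases n) auto
    ultimately show "(\<lambda>n. mscale (of_nat n) (mscale (z ^ n) (W n)) $ a $ b) sums (theta ?F z $ a $ b)"
      by (simp add: theta_def)
  qed
qed

section \<open>Contiguous terms of the series\<close>

lemma theta_pRq:
  assumes "z \<in> interior (pRq_domain p q C D A B)"
  shows "(\<lambda>n. mscale (of_nat n) (pRq_term p q C D A B z n)) sums theta (pRq p q C D A B) z"
proof -
  let ?W = "\<lambda>n. mscale (1 / fact n) (rGamma_mat (mscale (of_nat n) A + B)
        ** mprod (map (\<lambda>i. mpochhammer (C i) n) [1..<Suc p])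
        ** mprod (map (\<lambda>j. matrix_inv (mpochhammer (D j) n)) [1..<Suc q]))"
  have "pRq_term p q C D A B w = (\<lambda>n. mscale (w ^ n) (?W n))" for w
    by (simp add: fun_eq_iff pRq_term_def mscale_mscale)
  then show ?thesis
    using theta_power_series[of z ?W] assms by (simp add: pRq_def[abs_def] pRq_domain_def)
qed

text \<open>\<open>C i\<close> passes the reciprocal Gamma factor because it commutes with nA + B,
  becomes C_i + nI at the i-th Pochhammer symbol, and returns to the front. The lower product stays
  untouched at the right end.\<close>

lemma pRq_term_shift_up:
  fixes A B :: "complex^'n^'n"
  assumes i: "i \<in> {1..p}"
    and C: "\<And>k. k \<in> {1..p} \<Longrightarrow> commutes (C i) (C k)" and A: "commutes (C i) A" and B: "commutes (C i) B"
  shows "C i ** pRq_term p q (shift_up C i) D A B z n =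
    mscale (of_nat n) (pRq_term p q C D A B z n) + C i ** pRq_term p q C D A B z n"
proof -
  let ?G = "rGamma_mat (mscale (of_nat n) A + B)"
  let ?c = "\<lambda>k. mpochhammer (C k) n" and ?c' = "\<lambda>k. mpochhammer (shift_up C i k) n"
  let ?P = "mprod (map ?c [1..<Suc p])" and ?P' = "mprod (map ?c' [1..<Suc p])"
  let ?Q = "mprod (map (\<lambda>j. matrix_inv (mpochhammer (D j) n)) [1..<Suc q])"
  let ?M = "C i" and ?E = "C i + mat (of_nat n)"
  have "commutes ?M (mscale (of_nat n) A + B)"
    by (intro commutes_add commutes_mscale A B)
  then have G: "commutes ?M ?G"
    unfolding rGamma_mat_def by (intro commutes_entire_mat holomorphic_rGamma)
  then have GE: "commutes ?E ?G"
    by (simp add: matrix_add_ldistrib matrix_add_rdistrib mat_mult_left mat_mult_right)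
  have c: "commutes ?M (?c k)" if "k \<in> {1..p}" for k
    by (intro commutes_mpochhammer C that)
  have P: "?M ** ?P' = ?E ** ?P"
  proof (rule mprod_replace_factor[where i = i])
    show "commutes ?M (?c k)" "commutes ?E (?c k)" if "k \<in> set [1..<Suc p]" for k
      using c[of k] that
      by (auto simp: matrix_add_ldistrib matrix_add_rdistrib mat_mult_left mat_mult_right)
    show "?M ** ?c' i = ?E ** ?c i"
      by (simp add: shift_up_def mpochhammer_shift_up)
  qed (use i in \<open>auto simp: shift_up_def\<close>)
  have "?M ** (?G ** ?P' ** ?Q) = ?G ** (?M ** ?P') ** ?Q"
    by (simp add: matrix_mul_assoc G)
  also have "\<dots> = ?E ** (?G ** ?P ** ?Q)"
    unfolding P by (simp add: matrix_mul_assoc GE)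
  finally have "?M ** (?G ** ?P' ** ?Q) = ?E ** (?G ** ?P ** ?Q)" .
  then have "C i ** pRq_term p q (shift_up C i) D A B z n = ?E ** pRq_term p q C D A B z n"
    unfolding pRq_term_def mscale_mult_right by simp
  then show ?thesis
    by (simp add: matrix_add_rdistrib mat_mult_left add.commute)
qed

text \<open>The factor D_j - I multiplies from the right, next to the lower product. It has to pass
  only other lower factors, so commutation among the D_k suffices.\<close>

lemma pRq_term_shift_down:
  fixes A B :: "complex^'n^'n"
  assumes j: "j \<in> {1..q}" and D: "\<And>k. k \<in> {1..q} \<Longrightarrow> commutes (D j) (D k)"
    and adm: "lower_admissible q D" "lower_admissible q (shift_down D j)"
  shows "pRq_term p q C (shift_down D j) A B z n ** (D j - mat 1) =
    mscale (of_nat n) (pRq_term p q C D A B z n) + pRq_term p q C D A B z n ** (D j - mat 1)"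
proof -
  let ?H = "rGamma_mat (mscale (of_nat n) A + B) ** mprod (map (\<lambda>i. mpochhammer (C i) n) [1..<Suc p])"
  let ?d = "\<lambda>k. matrix_inv (mpochhammer (D k) n)"
  let ?d' = "\<lambda>k. matrix_inv (mpochhammer (shift_down D j k) n)"
  let ?Q = "mprod (map ?d [1..<Suc q])" and ?Q' = "mprod (map ?d' [1..<Suc q])"
  let ?M = "D j - mat 1" and ?E = "D j - mat 1 + mat (of_nat n)"
  have inv: "invertible (D k + mat (of_nat m))" if "k \<in> {1..q}" for k and m :: nat
    using adm(1) that by (auto simp: lower_admissible_def)
  have inv': "invertible (shift_down D j k + mat (of_nat m))" if "k \<in> {1..q}" for k and m :: nat
    using adm(2) that by (auto simp: lower_admissible_def)
  have M: "commutes ?M (D k)" if "k \<in> {1..q}" for k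
    using D[OF that] by (simp add: matrix_diff_ldistrib matrix_diff_rdistrib)
  have Md: "commutes ?M (?d k)" if "k \<in> {1..q}" for k
    by (intro commutes_matrix_inv invertible_mpochhammer inv commutes_mpochhammer M that)
  have Ed: "commutes ?E (?d k)" if "k \<in> {1..q}" for k
    using Md[OF that] by (simp add: matrix_add_ldistrib matrix_add_rdistrib mat_mult_left mat_mult_right)
  have Md': "commutes ?M (?d' k)" if "k \<in> {1..q}" for k
  proof (intro commutes_matrix_inv invertible_mpochhammer inv' commutes_mpochhammer that)
    show "commutes ?M (shift_down D j k)"
      using M[OF that] by (simp add: shift_down_def)
  qed
  have "?M ** ?Q' = ?E ** ?Q"
  proof (rule mprod_replace_factor[where i = j])
    show "?M ** ?d' j = ?E ** ?d j"
      using matrix_inv_mpochhammer_shift_down[of "D j" n] inv[OF j] inv'[OF j]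
      by (simp add: shift_down_def)
  qed (use j Md Ed in \<open>auto simp: shift_down_def\<close>)
  \<comment> \<open>The replacement was made with the multipliers in front of the lower products;
    commutation moves them behind.\<close>
  moreover have "commutes ?M ?Q'" "commutes ?E ?Q"
    using Md' Ed by (auto intro!: commutes_mprod)
  ultimately have "?Q' ** ?M = ?Q ** ?E"
    by simp
  then have "?H ** ?Q' ** ?M = ?H ** ?Q ** ?E"
    by (simp flip: matrix_mul_assoc)
  then have "pRq_term p q C (shift_down D j) A B z n ** ?M = pRq_term p q C D A B z n ** ?E"
    unfolding pRq_term_def mscale_mult_left by simp
  then show ?thesis
    by (simp add: matrix_add_ldistrib mat_mult_right add.commute)
qed

text \<open>A derivative needs a neighbourhood of \<open>z\<close>, hence \<open>interior V\<close>
  wherever \<open>theta\<close> occurs. The remaining relations are also stated at every point where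
  all three series converge. The guard \<open>1 \<le> p\<close> ensures that \<open>C 1\<close> is
  one of the parameters.\<close>

theorem mainTheorem2:
  fixes A B :: "complex^'n^'n"
    and C D :: "nat \<Rightarrow> complex^'n^'n"
    and p q :: nat
  defines "R \<equiv> pRq p q C D A B"
    and "Rup \<equiv> \<lambda>i. pRq p q (shift_up C i) D A B"
    and "Rdown \<equiv> \<lambda>j. pRq p q C (shift_down D j) A B"
    and "V \<equiv> pRq_domain p q C D A B"
    and "Vup \<equiv> \<lambda>i. pRq_domain p q (shift_up C i) D A B"
    and "Vdown \<equiv> \<lambda>j. pRq_domain p q C (shift_down D j) A B"
  assumes "\<forall>i\<in>{1..p}. positive_stable (C i)"
    and "\<forall>i\<in>{1..p}. (\<forall>k. 1 \<le> k \<and> k < i \<longrightarrow> C i ** C k = C k ** C i)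
           \<and> C i ** A = A ** C i \<and> C i ** B = B ** C i"
    and "\<forall>j\<in>{1..q}. \<forall>k. j < k \<and> k \<le> q \<longrightarrow> D j ** D k = D k ** D j"
    and "lower_admissible q D"
  shows
    "(\<forall>i\<in>{1..p}. \<forall>z\<in>interior V.
        theta R z + C i ** R z = C i ** Rup i z)
     \<and> (\<forall>j\<in>{1..q}. lower_admissible q (shift_down D j) \<longrightarrow> (\<forall>z\<in>interior V.
        theta R z + R z ** (D j - mat 1) = Rdown j z ** (D j - mat 1)))
     \<and> (\<forall>i\<in>{1..p}. \<forall>j\<in>{1..q}. lower_admissible q (shift_down D j) \<longrightarrow>
        (\<forall>z\<in>interior V \<union> (V \<inter> Vup i \<inter> Vdown j).
          C i ** R z - R z ** (D j - mat 1) = C i ** Rup i z - Rdown j z ** (D j - mat 1)))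
     \<and> (\<forall>i\<in>{2..p}. \<forall>z\<in>interior V \<union> (V \<inter> Vup 1 \<inter> Vup i).
        (C 1 - C i) ** R z = C 1 ** Rup 1 z - C i ** Rup i z)
     \<and> (1 \<le> p \<longrightarrow> (\<forall>j\<in>{1..q}. lower_admissible q (shift_down D j) \<longrightarrow>
        (\<forall>z\<in>interior V \<union> (V \<inter> Vup 1 \<inter> Vdown j).
          C 1 ** R z - R z ** (D j - mat 1) = C 1 ** Rup 1 z - Rdown j z ** (D j - mat 1))))"
proof -
  let ?T = "pRq_term p q C D A B"
  let ?Up = "\<lambda>i. pRq_term p q (shift_up C i) D A B"
  let ?Down = "\<lambda>j. pRq_term p q C (shift_down D j) A B"
  note sumsL = bounded_linear.sums[OF bounded_linear_matrix_mult_left]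
  note sumsR = bounded_linear.sums[OF bounded_linear_matrix_mult_right]

  \<comment> \<open>Sums of the series involved\<close>
  have R: "?T z sums R z" if "z \<in> V" for z
    using that by (simp add: R_def V_def pRq_def pRq_domain_def summable_sums)
  have Rup: "?Up i z sums Rup i z" if "z \<in> Vup i" for i z
    using that by (simp add: Rup_def Vup_def pRq_def pRq_domain_def summable_sums)
  have Rdown: "?Down j z sums Rdown j z" if "z \<in> Vdown j" for j z
    using that by (simp add: Rdown_def Vdown_def pRq_def pRq_domain_def summable_sums)
  have theta: "(\<lambda>n. mscale (of_nat n) (?T z n)) sums theta R z" if "z \<in> interior V" for z
    using theta_pRq that unfolding R_def V_def by blast
  have V: "z \<in> V" if "z \<in> interior V" for z
    using that interior_subset by blast

  \<comment> \<open>Contiguous relations between the terms\<close>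
  have up: "C i ** ?Up i z n = mscale (of_nat n) (?T z n) + C i ** ?T z n"
    if i: "i \<in> {1..p}" for i z n
  proof (rule pRq_term_shift_up[OF i])
    show "commutes (C i) (C k)" if "k \<in> {1..p}" for k
      \<comment> \<open>The hypothesis covers k < i; for k > i it is applied to \<open>k\<close> in
        place of \<open>i\<close>, and k = i is trivial.\<close>
      using assms(8) i that by (cases k i rule: linorder_cases) auto
  qed (use assms(8) i in auto)
  have down: "?Down j z n ** (D j - mat 1) = mscale (of_nat n) (?T z n) + ?T z n ** (D j - mat 1)"
    if j: "j \<in> {1..q}" and adm: "lower_admissible q (shift_down D j)" for j z n
  proof (rule pRq_term_shift_down[OF j _ assms(10) adm])
    show "commutes (D j) (D k)" if "k \<in> {1..q}" for k
      using assms(9) j that by (cases k j rule: linorder_cases) auto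
  qed

  \<comment> \<open>Relations between theta and a single shift\<close>
  have a_sums: "(\<lambda>n. C i ** ?Up i z n) sums (theta R z + C i ** R z)"
    if "i \<in> {1..p}" "z \<in> interior V" for i z
    unfolding up[OF that(1)] by (intro sums_add theta sumsL R V that)
  have Vup: "z \<in> Vup i" if "i \<in> {1..p}" "z \<in> interior V" for i z
    \<comment> \<open>Convergence is known for the series multiplied by \<open>C i\<close>; positive
      stability makes \<open>C i\<close> invertible, so it can be cancelled.\<close>
    using sums_summable[OF a_sums[OF that]] assms(7) that(1)
    by (simp add: Vup_def pRq_domain_def summable_matrix_mult_left_iff positive_stable_invertible)
  have a: "theta R z + C i ** R z = C i ** Rup i z" if "i \<in> {1..p}" "z \<in> interior V" for i z
    by (rule sums_unique2[OF a_sums[OF that] sumsL[OF Rup[OF Vup[OF that]]]])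

  have b_sums: "(\<lambda>n. ?Down j z n ** (D j - mat 1)) sums (theta R z + R z ** (D j - mat 1))"
    if "j \<in> {1..q}" "lower_admissible q (shift_down D j)" "z \<in> interior V" for j z
    unfolding down[OF that(1,2)] by (intro sums_add theta sumsR R V that)
  have Vdown: "z \<in> Vdown j"
    if "j \<in> {1..q}" "lower_admissible q (shift_down D j)" "z \<in> interior V" for j z
  proof -
    \<comment> \<open>Admissibility of the lowered parameters at k = 0 is invertibility of D_j - I,
      which permits its cancellation.\<close>
    have "invertible (shift_down D j j + mat (of_nat 0))"
      using that(1,2) unfolding lower_admissible_def by blast
    then have "invertible (D j - mat 1)"
      by (simp add: shift_down_def)
    then show ?thesis
      using sums_summable[OF b_sums[OF that]]
      by (simp add: Vdown_def pRq_domain_def summable_matrix_mult_right_iff)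
  qed
  have b: "theta R z + R z ** (D j - mat 1) = Rdown j z ** (D j - mat 1)"
    if "j \<in> {1..q}" "lower_admissible q (shift_down D j)" "z \<in> interior V" for j z
    by (rule sums_unique2[OF b_sums[OF that] sumsR[OF Rdown[OF Vdown[OF that]]]])

  \<comment> \<open>Relations without theta\<close>
  have c: "C i ** R z - R z ** (D j - mat 1) = C i ** Rup i z - Rdown j z ** (D j - mat 1)"
    if i: "i \<in> {1..p}" and j: "j \<in> {1..q}" "lower_admissible q (shift_down D j)"
      and z: "z \<in> interior V \<union> (V \<inter> Vup i \<inter> Vdown j)" for i j z
  proof -
    have z': "z \<in> V" "z \<in> Vup i" "z \<in> Vdown j"
      using z V Vup[OF i] Vdown[OF j] by auto
    have "(\<lambda>n. C i ** ?Up i z n - ?Down j z n ** (D j - mat 1))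
        sums (C i ** Rup i z - Rdown j z ** (D j - mat 1))"
      by (intro sums_diff sumsL sumsR Rup Rdown z')
    moreover have "(\<lambda>n. C i ** ?T z n - ?T z n ** (D j - mat 1))
        sums (C i ** R z - R z ** (D j - mat 1))"
      by (intro sums_diff sumsL sumsR R z')
    ultimately show ?thesis
      \<comment> \<open>The terms with factor n cancel in the difference, so no series of n T(n) has
        to converge.\<close>
      by (simp add: up[OF i] down[OF j] sums_iff)
  qed

  have d: "(C 1 - C i) ** R z = C 1 ** Rup 1 z - C i ** Rup i z"
    if "i \<in> {2..p}" and z: "z \<in> interior V \<union> (V \<inter> Vup 1 \<inter> Vup i)" for i z
  proof -
    have i: "1 \<in> {1..p}" "i \<in> {1..p}"
      using that(1) by auto
    have z': "z \<in> V" "z \<in> Vup 1" "z \<in> Vup i"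
      using z V Vup[OF i(1)] Vup[OF i(2)] by auto
    have "(\<lambda>n. C 1 ** ?Up 1 z n - C i ** ?Up i z n) sums (C 1 ** Rup 1 z - C i ** Rup i z)"
      by (intro sums_diff sumsL Rup z')
    moreover have "(\<lambda>n. C 1 ** ?T z n - C i ** ?T z n) sums (C 1 ** R z - C i ** R z)"
      by (intro sums_diff sumsL R z')
    ultimately show ?thesis
      by (simp add: up[OF i(1)] up[OF i(2)] sums_iff matrix_diff_rdistrib del: One_nat_def)
  qed

  show ?thesis
  proof (intro conjI ballI impI)
    show "theta R z + C i ** R z = C i ** Rup i z" if "i \<in> {1..p}" "z \<in> interior V" for i z
      using a that .
  qed (use b c d in auto)
qed

end
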